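(* Consider a multilayer perceptron with $L$ fully connected layers of constant layer size $d$ (each weight matrix is $d\times d$), with $N=d^2L$ weights and $n$ data points, and let $H\in\mathbb{R}^{N\times N}$ be its Gauss-Newton Hessian matrix, with associated vectors $v_k(i)\in\mathbb{R}^d$ and $v_k\in\mathbb{R}^{dn}$ (as defined in the context). For every entry $H_{km}$, the estimator $\tilde H_{km}$ returned by the Monte Carlo sampling algorithm described in the context with $c\ge 1$ random samples satisfies: 1. $\tilde H_{km}$ is an unbiased estimator of $H_{km}$, i.e. $\mathbb{E}[\tilde H_{km}]=H_{km}$. 2. Its variance (mean squared error) satisfies $$\mathrm{Var}[\tilde H_{km}]=\mathbb{E}\left[|H_{km}-\tilde H_{km}|^2\right]\le\frac1c\,\|v_k\|^2\,\|v_m\|^2 .$$ 3. For every $\delta\in(0,1)$, with probability at least $1-\delta$, $$|H_{km}-\tilde H_{km}|\le\frac{\eta}{\sqrt c}\,\|v_k\|\,\|v_m\|,\qquad \eta=1+\sqrt{8\log(1/\delta)} .$$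
   Context: Network: given data pairs $(x_i^0,y_i)$, $i=1,\dots,n$, with $x_i^0\in\mathbb{R}^d$, and weight matrices $W_\ell\in\mathbb{R}^{d\times d}$, $\ell=1,\dots,L$, the forward pass is $x_i^\ell=s(W_\ell x_i^{\ell-1})\in\mathbb{R}^d$ for $\ell=1,\dots,L$, where $s$ is a (differentiable) scalar activation function applied to every entry of its argument. The weight vector is $w=[\mathrm{vec}(W_1),\dots,\mathrm{vec}(W_L)]\in\mathbb{R}^N$, where $N=d^2L$ and $\mathrm{vec}$ is column-major vectorization. Gauss-Newton Hessian (GNH): $f(x_i^L,y_i)$ is the loss function, $Q_i=\frac1n\,\partial^2_{xx}f(x_i^L,y_i)\in\mathbb{R}^{d\times d}$ is ($\frac1n$ times) the Hessian of the loss with respect to its first argument, $J_i=\partial_w x_i^L\in\mathbb{R}^{d\times N}$ is the Jacobian of the network output with respect to the weights, and $$H=\sum_{i=1}^n J_i^TQ_iJ_i\in\mathbb{R}^{N\times N}.$$ Each $Q_i$ is symmetric positive semi-definite, with a fixed symmetric factorization $Q_i=R_i^TR_i$, $R_i\in\mathbb{R}^{d\times d}$. With $e_k$ the $k$-th canonical basis vector of $\mathbb{R}^N$, set $$v_k(i)=R_iJ_ie_k\in\mathbb{R}^d,\qquad v_k=[v_k(1),\dots,v_k(n)]\in\mathbb{R}^{dn},$$ for $k=1,\dots,N$ and $i=1,\dots,n$, so that $H_{km}=\sum_{i=1}^n v_k(i)^Tv_m(i)=v_k^Tv_m$. $\|\cdot\|$ is the Euclidean norm and $\log$ is the natural logarithm.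 Monte Carlo sampling algorithm (for fixed $k,m$ and number of samples $c$): define the probability distribution on $\{1,\dots,n\}$ $$P_{km}(t)=\frac{\|v_k(t)\|\,\|v_m(t)\|}{\sum_{j=1}^n\|v_k(j)\|\,\|v_m(j)\|},\qquad t=1,\dots,n$$ (the denominator is assumed nonzero, so that $P_{km}$ is well defined). Draw $c$ independent random samples $t_1,\dots,t_c$ from $\{1,\dots,n\}$ with replacement, each distributed according to $P_{km}$, and output $$\tilde H_{km}=\frac1c\sum_{j=1}^c\frac{v_k(t_j)^Tv_m(t_j)}{P_{km}(t_j)} .$$ *)

theory Defs
  imports "HOL-Probability.Probability"
begin

text \<open>
  \<open>'d rvec\<close> is \<open>real ^ 'd\<close> and \<open>('r, 'c) rmat\<close>, with \<open>'r\<close> rows and \<open>'c\<close> columns, is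
  \<open>real ^ 'c ^ 'r\<close>. The postfix notation is avoided because it imposes the sort \<open>finite\<close> on every
  unannotated index type, which conflicts with the sort needed for ordered indices.
\<close>

type_synonym 'd rvec = "(real, 'd) vec"
type_synonym ('r, 'c) rmat = "('c rvec, 'r) vec"


section \<open>The multilayer perceptron\<close>

primrec forward ::
  "(real \<Rightarrow> real) \<Rightarrow> (nat \<Rightarrow> real ^ 'd ^ 'd) \<Rightarrow> real ^ 'd \<Rightarrow> nat \<Rightarrow> real ^ 'd" where
  "forward s W x 0 = x"
| "forward s W x (Suc l) = (\<chi> a. s ((W (Suc l) *v forward s W x l) $ a))"

text \<open>
  Row, column and weight indices are elements of finite linearly ordered types; every finite size
  is realised by such a type. \<open>pos\<close> is the zero-based position of an index in its type and
  \<open>nth_index\<close> its inverse.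
\<close>

definition pos :: "'a :: {finite, linorder} \<Rightarrow> nat" where
  "pos a = card {..<a}"

definition nth_index :: "nat \<Rightarrow> 'a :: {finite, linorder}" where
  "nth_index = inv pos"

text \<open>
  \<open>weight_vector W\<close> is \<open>[vec(W\<^sub>1), ..., vec(W\<^sub>L)]\<close> with column-major \<open>vec\<close>, where
  \<open>L * d\<^sup>2\<close> is the size of the index type \<open>'w\<close>: entry \<open>(a, b)\<close> of the matrix of layer \<open>l\<close>
  sits at the zero-based position \<open>(l - 1) * d\<^sup>2 + b * d + a\<close>. The function \<open>weight_matrix\<close>
  recovers the matrices of the layers \<open>1, ..., L\<close> from such a vector.
\<close>

definition weight_vector ::
  "(nat \<Rightarrow> ('d :: {finite, linorder}, 'd) rmat) \<Rightarrow> ('w :: {finite, linorder}) rvec" where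
  "weight_vector W = (\<chi> k.
     W (pos k div CARD('d)\<^sup>2 + 1)
       $ nth_index (pos k mod CARD('d)) $ nth_index (pos k mod CARD('d)\<^sup>2 div CARD('d)))"

definition weight_matrix ::
  "('w :: {finite, linorder}) rvec \<Rightarrow> nat \<Rightarrow> ('d :: {finite, linorder}, 'd) rmat" where
  "weight_matrix w l =
     (\<chi> a b. w $ nth_index ((l - 1) * CARD('d)\<^sup>2 + pos b * CARD('d) + pos a))"

lemma pos_strict_mono: "a < b \<Longrightarrow> pos a < pos b"
  unfolding pos_def by (intro psubset_card_mono) auto

lemma bij_betw_pos: "bij_betw pos (UNIV :: 'a set) {..<CARD('a :: {finite, linorder})}"
proof -
  have inj: "inj (pos :: 'a \<Rightarrow> nat)"
    by (metis injI linorder_neqE nat_neq_iff pos_strict_mono)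
  have "pos a < CARD('a)" for a :: 'a
    unfolding pos_def by (intro psubset_card_mono) auto
  hence "range (pos :: 'a \<Rightarrow> nat) \<subseteq> {..<CARD('a)}"
    by auto
  moreover have "card (range (pos :: 'a \<Rightarrow> nat)) = CARD('a)"
    using inj by (simp add: card_image)
  ultimately have "range (pos :: 'a \<Rightarrow> nat) = {..<CARD('a)}"
    by (intro card_subset_eq) auto
  with inj show ?thesis
    by (simp add: bij_betw_def)
qed

lemma nth_index_pos [simp]: "nth_index (pos a) = a"
  unfolding nth_index_def using bij_betw_pos by (metis bij_betw_def inv_f_f)

lemma pos_nth_index [simp]:
  "p < CARD('a) \<Longrightarrow> pos (nth_index p :: 'a :: {finite, linorder}) = p"
  unfolding nth_index_def using bij_betw_pos[where 'a = 'a]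
  by (metis bij_betw_def f_inv_into_f lessThan_iff)

lemma pos_less [simp]: "pos (a :: 'a :: {finite, linorder}) < CARD('a)"
  using bij_betw_pos[where 'a = 'a] by (auto simp: bij_betw_def)

lemma weight_matrix_weight_vector:
  fixes W :: "nat \<Rightarrow> ('d :: {finite, linorder}, 'd) rmat"
  assumes "CARD('w :: {finite, linorder}) = CARD('d)\<^sup>2 * L" and "l \<in> {1..L}"
  shows "weight_matrix (weight_vector W :: 'w rvec) l = W l"
proof -
  define D where "D = CARD('d)"
  have "weight_matrix (weight_vector W :: 'w rvec) l $ a $ b = W l $ a $ b" for a b :: 'd
  proof -
    define q where "q = pos b * D + pos a"
    have a: "pos a < D" and b: "pos b < D"
      by (simp_all add: D_def)
    have "q < pos b * D + D"
      using a by (simp add: q_def)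
    also have "\<dots> = (pos b + 1) * D"
      by simp
    also have "\<dots> \<le> D * D"
      using b by (intro mult_right_mono) auto
    finally have q: "q < D\<^sup>2"
      by (simp add: power2_eq_square)
    have "(l - 1) * D\<^sup>2 + q < (l - 1) * D\<^sup>2 + D\<^sup>2"
      using q by simp
    also have "\<dots> = (l - 1 + 1) * D\<^sup>2"
      by simp
    also have "\<dots> \<le> L * D\<^sup>2"
      using assms(2) by (intro mult_right_mono) auto
    finally have less: "(l - 1) * D\<^sup>2 + q < CARD('w)"
      using assms(1) by (simp add: D_def mult.commute)
    have mod: "((l - 1) * D\<^sup>2 + q) mod D = pos a"
      using a by (simp add: q_def power2_eq_square mod_add_left_eq flip: mult.assoc)
    have "weight_matrix (weight_vector W :: 'w rvec) l $ a $ b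
        = W (((l - 1) * D\<^sup>2 + q) div D\<^sup>2 + 1)
            $ nth_index (((l - 1) * D\<^sup>2 + q) mod D) $ nth_index (((l - 1) * D\<^sup>2 + q) mod D\<^sup>2 div D)"
      using less by (simp add: weight_matrix_def weight_vector_def D_def q_def add.assoc)
    also have "\<dots> = W l $ a $ b"
      using q mod a b assms(2) by (simp add: q_def)
    finally show ?thesis .
  qed
  thus ?thesis
    by (simp add: vec_eq_iff)
qed

lemma forward_differentiable:
  fixes x :: "'d :: {finite, linorder} rvec" and w :: "'w :: {finite, linorder} rvec"
  assumes "\<And>z. s differentiable (at z)"
  shows "(\<lambda>w. forward s (weight_matrix w) x l) differentiable (at w)"
proof (induction l)
  case (Suc l)
  let ?A = "\<lambda>w :: 'w rvec. weight_matrix w (Suc l) :: ('d, 'd) rmat"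
  let ?z = "\<lambda>w a. \<Sum>b\<in>UNIV. ?A w $ a $ b * forward s (weight_matrix w) x l $ b"
  have proj: "(\<lambda>w. g w $ b) differentiable (at w)"
    if "g differentiable (at w)" for g :: "'w rvec \<Rightarrow> 'd rvec" and b
    using that bounded_linear.has_derivative[OF bounded_linear_vec_nth]
    unfolding differentiable_def by blast
  have A: "(\<lambda>w. ?A w $ a $ b) differentiable (at w)" for a b
    by (simp add: weight_matrix_def bounded_linear_imp_differentiable bounded_linear_vec_nth)
  have "(\<lambda>w. ?z w a) differentiable (at w)" for a
    by (intro differentiable_sum ballI differentiable_mult A proj[OF Suc.IH] finite)
  hence "(\<lambda>w. s (?z w a)) differentiable (at w)" for a
    using differentiable_chain_at[of "\<lambda>w. ?z w a" w s] assms by (simp add: o_def)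
  hence "\<forall>a. \<exists>D. ((\<lambda>w. s (?z w a)) has_derivative D) (at w)"
    unfolding differentiable_def by blast
  from choice[OF this] obtain D where "\<forall>a. ((\<lambda>w. s (?z w a)) has_derivative D a) (at w)" ..
  hence "((\<lambda>w. \<chi> a. s (?z w a)) has_derivative (\<lambda>h. \<chi> a. D a h)) (at w)"
    by (subst has_derivative_componentwise_within)
      (auto simp: Basis_vec_def inner_axis)
  thus ?case
    by (auto simp: matrix_vector_mult_def differentiable_def)
qed simp


section \<open>The Gauss-Newton Hessian\<close>

definition grad :: "(real ^ 'd \<Rightarrow> real) \<Rightarrow> real ^ 'd \<Rightarrow> real ^ 'd" where
  "grad g x = (\<chi> a. frechet_derivative g (at x) (axis a 1))"

definition twice_differentiable_at :: "(real ^ 'd \<Rightarrow> real) \<Rightarrow> real ^ 'd \<Rightarrow> bool" where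
  "twice_differentiable_at g x \<longleftrightarrow>
     (\<forall>\<^sub>F z in nhds x. g differentiable (at z)) \<and> grad g differentiable (at x)"

definition hessian :: "(real ^ 'd \<Rightarrow> real) \<Rightarrow> real ^ 'd \<Rightarrow> real ^ 'd ^ 'd" where
  "hessian g x = jacobian (grad g) (at x)"

text \<open>The Jacobian, at the weights \<open>W\<close>, of the network output as a function of the weight vector.\<close>

definition output_jacobian ::
  "(real \<Rightarrow> real) \<Rightarrow> nat \<Rightarrow> (nat \<Rightarrow> ('d, 'd) rmat) \<Rightarrow> 'd rvec
     \<Rightarrow> ('d :: {finite, linorder}, 'w :: {finite, linorder}) rmat" where
  "output_jacobian s L W x =
     jacobian (\<lambda>w. forward s (weight_matrix w) x L) (at (weight_vector W))"

definition gauss_newton_hessian ::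
  "('n :: finite \<Rightarrow> real ^ 'w ^ 'd) \<Rightarrow> ('n \<Rightarrow> real ^ 'd ^ 'd) \<Rightarrow> real ^ 'w ^ 'w" where
  "gauss_newton_hessian J Q = (\<Sum>i\<in>UNIV. transpose (J i) ** Q i ** J i)"

text \<open>
  The vector \<open>v\<^sub>k\<close> in block form: block \<open>i\<close> is \<open>v\<^sub>k(i)\<close>. The norm on this type is the Euclidean
  norm of the concatenation of the blocks.
\<close>

definition gnh_vector ::
  "('n :: finite \<Rightarrow> real ^ 'd ^ 'd) \<Rightarrow> ('n \<Rightarrow> real ^ 'w ^ 'd) \<Rightarrow> 'w :: finite \<Rightarrow> real ^ 'd ^ 'n" where
  "gnh_vector R J k = (\<chi> i. R i *v (J i *v axis k 1))"


section \<open>The Monte Carlo estimator\<close>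

definition sampling_prob :: "real ^ 'd ^ 'n \<Rightarrow> real ^ 'd ^ 'n \<Rightarrow> 'n :: finite \<Rightarrow> real" where
  "sampling_prob u v t = norm (u $ t) * norm (v $ t) / (\<Sum>j\<in>UNIV. norm (u $ j) * norm (v $ j))"

definition mc_estimate :: "real ^ 'd ^ 'n \<Rightarrow> real ^ 'd ^ 'n \<Rightarrow> nat \<Rightarrow> (nat \<Rightarrow> 'n :: finite) \<Rightarrow> real" where
  "mc_estimate u v c t =
     1 / real c * (\<Sum>j = 1..c. (u $ t j) \<bullet> (v $ t j) / sampling_prob u v (t j))"

end

theory Submission
  imports Defs
begin

text \<open>
  The samples \<open>X\<^sub>j = v\<^sub>k(t\<^sub>j)\<^sup>T v\<^sub>m(t\<^sub>j) / P(t\<^sub>j)\<close> have mean \<open>H\<^sub>k\<^sub>m\<close> and, by Cauchy-Schwarz applied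
  twice, \<open>\<bar>X\<^sub>j\<bar> \<le> \<Sum>\<^sub>i \<parallel>v\<^sub>k(i)\<parallel> \<parallel>v\<^sub>m(i)\<parallel> \<le> \<parallel>v\<^sub>k\<parallel> \<parallel>v\<^sub>m\<parallel>\<close>. Independence turns this into the variance
  bound. Hoeffding's inequality alone does not give the constant \<open>\<eta>\<close>: its two-sided form carries a
  factor 2, which is too large when \<open>\<delta>\<close> is close to 1. There Chebyshev's inequality takes over,
  since \<open>1 / \<eta>\<^sup>2 \<le> \<delta>\<close> as long as \<open>ln (1 / \<delta>) \<le> 1\<close>.
\<close>

section \<open>Means of independent bounded random variables\<close>

text \<open>Expand the square into a double sum: for distinct \<open>i\<close> and \<open>j\<close>
  independence factors the mixed moment into a product of means, which is zero, so only the diagonal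
  survives.\<close>

lemma (in prob_space) expectation_square_sum_indep_centered:
  fixes Y :: "'i \<Rightarrow> 'a \<Rightarrow> real"
  assumes fin: "finite I" and indep: "indep_vars (\<lambda>_. borel) Y I"
    and square: "\<And>i. i \<in> I \<Longrightarrow> integrable M (\<lambda>\<omega>. (Y i \<omega>)\<^sup>2)"
    and centered: "\<And>i. i \<in> I \<Longrightarrow> expectation (Y i) = 0"
  shows "expectation (\<lambda>\<omega>. (\<Sum>i\<in>I. Y i \<omega>)\<^sup>2) = (\<Sum>i\<in>I. expectation (\<lambda>\<omega>. (Y i \<omega>)\<^sup>2))"
proof -
  have rv: "random_variable borel (Y i)" if "i \<in> I" for i
    using indep that by (auto simp: indep_vars_def)
  have int: "integrable M (Y i)" if "i \<in> I" for i
    using square_integrable_imp_integrable[OF rv square] that by blast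
  have pair: "integrable M (\<lambda>\<omega>. Y i \<omega> * Y j \<omega>)
      \<and> expectation (\<lambda>\<omega>. Y i \<omega> * Y j \<omega>) = (if i = j then expectation (\<lambda>\<omega>. (Y i \<omega>)\<^sup>2) else 0)"
    if ij: "i \<in> I" "j \<in> I" for i j
  proof (cases "i = j")
    case True
    thus ?thesis
      using square[OF ij(1)] by (simp add: power2_eq_square)
  next
    case False
    have "indep_vars (\<lambda>_. borel) Y {i, j}"
      using indep_vars_subset[OF indep] ij by simp
    thus ?thesis
      using indep_vars_integrable[of "{i, j}" Y] indep_vars_lebesgue_integral[of "{i, j}" Y]
        int ij centered False by auto
  qed
  have "expectation (\<lambda>\<omega>. (\<Sum>i\<in>I. Y i \<omega>)\<^sup>2) = expectation (\<lambda>\<omega>. \<Sum>i\<in>I. \<Sum>j\<in>I. Y i \<omega> * Y j \<omega>)"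
    by (simp add: power2_eq_square sum_product)
  also have "\<dots> = (\<Sum>i\<in>I. \<Sum>j\<in>I. expectation (\<lambda>\<omega>. Y i \<omega> * Y j \<omega>))"
    using pair by (simp add: Bochner_Integration.integral_sum Bochner_Integration.integrable_sum)
  also have "\<dots> = (\<Sum>i\<in>I. \<Sum>j\<in>I. if i = j then expectation (\<lambda>\<omega>. (Y i \<omega>)\<^sup>2) else 0)"
    using pair by (intro sum.cong refl) blast
  finally show ?thesis
    using fin by simp
qed

text \<open>Collects what the variance and tail bounds ask of the samples: independence, a common
  mean and a common absolute bound. The Monte Carlo terms enter as the instance with index set
  \<open>{1..c}\<close>.\<close>

locale indep_abs_bounded_same_mean = prob_space +
  fixes X :: "'i \<Rightarrow> 'a \<Rightarrow> real" and I :: "'i set" and b \<mu> :: real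
  assumes fin: "finite I" and nonempty: "I \<noteq> {}"
    and indep: "indep_vars (\<lambda>_. borel) X I"
    and bound: "\<And>i \<omega>. i \<in> I \<Longrightarrow> \<omega> \<in> space M \<Longrightarrow> \<bar>X i \<omega>\<bar> \<le> b"
    and mean: "\<And>i. i \<in> I \<Longrightarrow> expectation (X i) = \<mu>"
begin

section \<open>Moments of the sample mean\<close>

abbreviation sample_mean :: "'a \<Rightarrow> real" where
  "sample_mean \<omega> \<equiv> 1 / real (card I) * (\<Sum>i\<in>I. X i \<omega>)"

lemma card_pos: "0 < card I"
  using fin nonempty by (simp add: card_gt_0_iff)

lemma random_variable [measurable]: "i \<in> I \<Longrightarrow> random_variable borel (X i)"
  using indep by (auto simp: indep_vars_def)

lemma integrable: "i \<in> I \<Longrightarrow> integrable M (X i)"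
  using bound by (intro integrable_const_bound[of _ b]) (auto intro!: AE_I2)

lemma square_le: "i \<in> I \<Longrightarrow> \<omega> \<in> space M \<Longrightarrow> (X i \<omega>)\<^sup>2 \<le> b\<^sup>2"
  using bound by (metis abs_ge_zero order_trans power2_abs power_mono)

lemma integrable_square: "i \<in> I \<Longrightarrow> integrable M (\<lambda>\<omega>. (X i \<omega>)\<^sup>2)"
  using square_le by (intro integrable_const_bound[of _ "b\<^sup>2"]) (auto intro!: AE_I2)

lemma expectation_sample_mean: "expectation sample_mean = \<mu>"
  using card_pos by (simp add: Bochner_Integration.integral_sum integrable mean)

lemma integrable_square_sample_mean: "integrable M (\<lambda>\<omega>. (sample_mean \<omega>)\<^sup>2)"
proof (rule integrable_const_bound[of _ "b\<^sup>2"])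
  have "\<bar>sample_mean \<omega>\<bar> \<le> b" if "\<omega> \<in> space M" for \<omega>
  proof -
    have "\<bar>\<Sum>i\<in>I. X i \<omega>\<bar> \<le> (\<Sum>i\<in>I. b)"
      using bound that by (intro order_trans[OF sum_abs] sum_mono)
    thus ?thesis
      using card_pos by (simp add: field_simps)
  qed
  hence "(sample_mean \<omega>)\<^sup>2 \<le> b\<^sup>2" if "\<omega> \<in> space M" for \<omega>
    using that by (metis abs_ge_zero power2_abs power_mono)
  thus "AE \<omega> in M. norm ((sample_mean \<omega>)\<^sup>2) \<le> b\<^sup>2"
    by (auto intro!: AE_I2)
qed measurable

text \<open>Each variance is at most the second moment, hence at most \<open>b\<^sup>2\<close>. By
  independence the variances add up to at most n times this, and averaging divides by the square of
  n, for n the size of \<open>I\<close>.\<close>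

lemma variance_sample_mean_le: "variance sample_mean \<le> b\<^sup>2 / real (card I)"
proof -
  let ?n = "real (card I)"
  have var: "variance (X i) = expectation (\<lambda>\<omega>. (X i \<omega>)\<^sup>2) - \<mu>\<^sup>2" if "i \<in> I" for i
    using variance_eq[OF integrable integrable_square] mean that by simp
  have second: "expectation (\<lambda>\<omega>. (X i \<omega>)\<^sup>2) \<le> b\<^sup>2" if "i \<in> I" for i
    using integral_mono[OF integrable_square integrable_const, of i "b\<^sup>2"] square_le that
    by (simp add: prob_space)
  have shift: "sample_mean \<omega> - \<mu> = 1 / ?n * (\<Sum>i\<in>I. X i \<omega> - \<mu>)" for \<omega>
    using card_pos by (simp add: sum_subtractf field_simps)
  have "variance sample_mean = 1 / ?n\<^sup>2 * expectation (\<lambda>\<omega>. (\<Sum>i\<in>I. X i \<omega> - \<mu>)\<^sup>2)"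
    unfolding expectation_sample_mean shift power_mult_distrib by (simp add: power_divide)
  also have "expectation (\<lambda>\<omega>. (\<Sum>i\<in>I. X i \<omega> - \<mu>)\<^sup>2) = (\<Sum>i\<in>I. expectation (\<lambda>\<omega>. (X i \<omega> - \<mu>)\<^sup>2))"
  proof (rule expectation_square_sum_indep_centered[OF fin])
    show "indep_vars (\<lambda>_. borel) (\<lambda>i \<omega>. X i \<omega> - \<mu>) I"
      by (rule indep_vars_compose2[OF indep]) measurable
  next
    fix i assume i: "i \<in> I"
    show "integrable M (\<lambda>\<omega>. (X i \<omega> - \<mu>)\<^sup>2)"
      using i integrable[OF i] integrable_square[OF i] by (simp add: power2_diff)
    show "expectation (\<lambda>\<omega>. X i \<omega> - \<mu>) = 0"
      using i integrable mean by (simp add: prob_space)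
  qed
  also have "\<dots> \<le> (\<Sum>i\<in>I. b\<^sup>2)"
  proof (rule sum_mono)
    fix i assume i: "i \<in> I"
    have "expectation (\<lambda>\<omega>. (X i \<omega> - \<mu>)\<^sup>2) = expectation (\<lambda>\<omega>. (X i \<omega>)\<^sup>2) - \<mu>\<^sup>2"
      using var[OF i] mean[OF i] by simp
    also have "\<dots> \<le> b\<^sup>2"
      using second[OF i] zero_le_power2[of \<mu>] by linarith
    finally show "expectation (\<lambda>\<omega>. (X i \<omega> - \<mu>)\<^sup>2) \<le> b\<^sup>2" .
  qed
  finally show ?thesis
    using card_pos by (simp add: field_simps power2_eq_square)
qed

section \<open>Tail bounds for the sample mean\<close>

lemma Chebyshev_sample_mean:
  assumes "0 < \<epsilon>"
  shows "prob {\<omega> \<in> space M. \<epsilon> \<le> \<bar>sample_mean \<omega> - \<mu>\<bar>} \<le> b\<^sup>2 / (real (card I) * \<epsilon>\<^sup>2)"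
proof -
  have "prob {\<omega> \<in> space M. \<epsilon> \<le> \<bar>sample_mean \<omega> - \<mu>\<bar>} \<le> variance sample_mean / \<epsilon>\<^sup>2"
    using Chebyshev_inequality[OF _ integrable_square_sample_mean assms]
    unfolding expectation_sample_mean by measurable
  also have "\<dots> \<le> b\<^sup>2 / real (card I) / \<epsilon>\<^sup>2"
    by (intro divide_right_mono variance_sample_mean_le) simp
  finally show ?thesis
    by simp
qed

lemma Hoeffding_sample_mean:
  assumes "0 < b" and "0 \<le> \<epsilon>"
  shows "prob {\<omega> \<in> space M. \<epsilon> \<le> \<bar>sample_mean \<omega> - \<mu>\<bar>} \<le> 2 * exp (- (real (card I) * \<epsilon>\<^sup>2 / (2 * b\<^sup>2)))"
proof -
  let ?n = "real (card I)"
  interpret Hoeffding_ineq M I X "\<lambda>_. - b" "\<lambda>_. b" "\<Sum>i\<in>I. expectation (X i)"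
  proof unfold_locales
    fix i assume "i \<in> I"
    thus "AE \<omega> in M. X i \<omega> \<in> {- b..b}"
      using bound by (auto intro!: AE_I2 simp: abs_le_iff minus_le_iff)
  qed (use fin indep in auto)
  \<comment> \<open>The inequality available concerns the unnormalised sum, so the deviation is
    multiplied by the number of samples.\<close>
  have "\<epsilon> \<le> \<bar>sample_mean \<omega> - \<mu>\<bar> \<longleftrightarrow> ?n * \<epsilon> \<le> \<bar>(\<Sum>i\<in>I. X i \<omega>) - (\<Sum>i\<in>I. expectation (X i))\<bar>" for \<omega>
  proof -
    have "\<bar>(\<Sum>i\<in>I. X i \<omega>) - (\<Sum>i\<in>I. expectation (X i))\<bar> = \<bar>?n * (sample_mean \<omega> - \<mu>)\<bar>"
      using card_pos by (simp add: mean right_diff_distrib)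
    also have "\<dots> = ?n * \<bar>sample_mean \<omega> - \<mu>\<bar>"
      by (simp only: abs_mult abs_of_nat)
    finally show ?thesis
      using card_pos by simp
  qed
  hence "prob {\<omega> \<in> space M. \<epsilon> \<le> \<bar>sample_mean \<omega> - \<mu>\<bar>}
      \<le> 2 * exp (- 2 * (?n * \<epsilon>)\<^sup>2 / (\<Sum>i\<in>I. (b - - b)\<^sup>2))"
    using Hoeffding_ineq_abs_ge[of "?n * \<epsilon>"] card_pos assms by simp
  \<comment> \<open>Each variable ranges over an interval of length \<open>2 * b\<close>; this
    length yields the 2 in the denominator of the final exponent.\<close>
  also have "- 2 * (?n * \<epsilon>)\<^sup>2 / (\<Sum>i\<in>I. (b - - b)\<^sup>2) = - (?n * \<epsilon>\<^sup>2 / (2 * b\<^sup>2))"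
    using card_pos assms by (simp add: field_simps power2_eq_square)
  finally show ?thesis .
qed

lemma sample_mean_concentration:
  assumes b: "0 < b" and \<delta>: "0 < \<delta>" "\<delta> < 1"
  shows "1 - \<delta> \<le> prob {\<omega> \<in> space M.
    \<bar>\<mu> - sample_mean \<omega>\<bar> \<le> (1 + sqrt (8 * ln (1 / \<delta>))) / sqrt (real (card I)) * b}"
proof -
  define l where "l = ln (1 / \<delta>)"
  define \<eta> where "\<eta> = 1 + sqrt (8 * l)"
  define \<epsilon> where "\<epsilon> = \<eta> / sqrt (real (card I)) * b"
  let ?B = "{\<omega> \<in> space M. \<epsilon> \<le> \<bar>sample_mean \<omega> - \<mu>\<bar>}"
  let ?G = "{\<omega> \<in> space M. \<bar>\<mu> - sample_mean \<omega>\<bar> \<le> \<epsilon>}"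
  have l: "0 < l"
    using \<delta> by (simp add: l_def)
  have \<delta>_eq: "\<delta> = exp (- l)"
    using \<delta> by (simp add: l_def ln_div)
  have "0 < \<eta>"
    using l by (simp add: \<eta>_def add_pos_nonneg)
  hence \<epsilon>: "0 < \<epsilon>"
    using b card_pos by (simp add: \<epsilon>_def)
  \<comment> \<open>The choice of \<epsilon> makes the sample count and \<open>b\<close> cancel:
    Chebyshev then reads 1 / \<eta>^2 and Hoeffding 2 exp (- \<eta>^2 / 2).\<close>
  have scaled: "real (card I) * \<epsilon>\<^sup>2 = \<eta>\<^sup>2 * b\<^sup>2"
    using card_pos by (simp add: \<epsilon>_def power_mult_distrib power_divide)
  \<comment> \<open>The nonnegative cross term \<open>2 * sqrt (8 * l)\<close> of the square is
    dropped.\<close>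
  have \<eta>2: "1 + 8 * l \<le> \<eta>\<^sup>2"
    using l by (simp add: \<eta>_def power2_sum)
  have "prob ?B \<le> \<delta>"
  proof (cases "l \<le> 1")
    case True
    have "prob ?B \<le> 1 / \<eta>\<^sup>2"
      using Chebyshev_sample_mean[OF \<epsilon>] b by (simp add: scaled)
    also have "\<dots> \<le> 1 / exp l"
    proof (rule divide_left_mono)
      \<comment> \<open>This quadratic bound on exp is valid on [0, 1], which is why the case split
        is at 1. There \<open>l\<^sup>2\<close> is at most \<open>l\<close>, so
        \<open>1 + 2 * l\<close> would already suffice.\<close>
      have "exp l \<le> 1 + l + l\<^sup>2"
        using l True by (intro exp_bound) auto
      also have "\<dots> \<le> 1 + 8 * l"
        using mult_left_le[of l l] l True by (simp add: power2_eq_square)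
      finally show "exp l \<le> \<eta>\<^sup>2"
        using \<eta>2 by linarith
    qed (use \<open>0 < \<eta>\<close> in auto)
    finally show ?thesis
      by (simp add: \<delta>_eq exp_minus field_simps)
  next
    case False
    have "prob ?B \<le> 2 * exp (- (\<eta>\<^sup>2 / 2))"
      using Hoeffding_sample_mean[OF b, of \<epsilon>] \<epsilon> b by (simp add: scaled)
    \<comment> \<open>The two-sided factor 2 is absorbed into e, so that the bound becomes a single
      exponential.\<close>
    also have "\<dots> \<le> exp 1 * exp (- (\<eta>\<^sup>2 / 2))"
      using exp_ge_add_one_self[of 1] by (intro mult_right_mono) auto
    also have "\<dots> = exp (1 - \<eta>\<^sup>2 / 2)"
      by (simp flip: exp_add)
    \<comment> \<open>The exponent is at most \<open>1/2 - 4 * l\<close>, which lies below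
      \<open>- l\<close> because \<open>l > 1\<close>.\<close>
    also have "\<dots> \<le> \<delta>"
      using \<eta>2 False by (simp add: \<delta>_eq)
    finally show ?thesis .
  qed
  moreover have "1 - prob ?B \<le> prob ?G"
  proof -
    have "1 - prob ?B = prob (space M - ?B)"
      by (intro prob_compl[symmetric]) measurable
    \<comment> \<open>The complement of \<open>?B\<close> is the strict event, hence contained in
      \<open>?G\<close>.\<close>
    also have "\<dots> \<le> prob ?G"
      by (intro finite_measure_mono) auto
    finally show ?thesis .
  qed
  ultimately show ?thesis
    by (simp add: \<epsilon>_def \<eta>_def l_def)
qed

end


section \<open>The sampled terms\<close>

text \<open>Since \<open>T\<close> takes finitely many values, g(T) is a finite combination of
  indicators of the level sets of \<open>T\<close>.\<close>

lemma (in prob_space) expectation_finite_range: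
  fixes g :: "'b :: finite \<Rightarrow> real"
  assumes T [measurable]: "T \<in> measurable M (count_space UNIV)"
  shows "expectation (\<lambda>\<omega>. g (T \<omega>)) = (\<Sum>t\<in>UNIV. prob {\<omega> \<in> space M. T \<omega> = t} * g t)"
proof -
  have "expectation (\<lambda>\<omega>. g (T \<omega>))
      = expectation (\<lambda>\<omega>. \<Sum>t\<in>UNIV. g t * indicator {\<omega> \<in> space M. T \<omega> = t} \<omega>)"
  proof (rule Bochner_Integration.integral_cong[OF refl])
    fix \<omega> assume "\<omega> \<in> space M"
    hence "(\<Sum>t\<in>UNIV. g t * indicator {\<omega> \<in> space M. T \<omega> = t} \<omega>)
        = (\<Sum>t\<in>UNIV. if T \<omega> = t then g t else 0)"
      by (intro sum.cong) (auto simp: indicator_def)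
    thus "g (T \<omega>) = (\<Sum>t\<in>UNIV. g t * indicator {\<omega> \<in> space M. T \<omega> = t} \<omega>)"
      by simp
  qed
  also have "\<dots> = (\<Sum>t\<in>UNIV. g t * prob {\<omega> \<in> space M. T \<omega> = t})"
    by (subst Bochner_Integration.integral_sum) (auto simp: Int_absorb2 Collect_restrict emeasure_eq_measure)
  finally show ?thesis
    by (simp add: mult.commute)
qed

text \<open>This cancellation is the source of unbiasedness. It survives at indices of probability
  zero: there one of the two blocks is the zero vector, so both sides vanish.\<close>

lemma sampling_prob_mult_ratio:
  assumes "(\<Sum>j\<in>UNIV. norm (u $ j) * norm (v $ j)) \<noteq> 0"
  shows "sampling_prob u v t * ((u $ t) \<bullet> (v $ t) / sampling_prob u v t) = (u $ t) \<bullet> (v $ t)"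
  using assms by (auto simp: sampling_prob_def)

text \<open>Sampling proportionally to the product of block norms turns the ratio into the
  normalised inner product times the total weight, and Cauchy-Schwarz bounds the former by 1.
  Division by zero gives 0, which keeps the bound true in degenerate cases.\<close>

lemma abs_inner_div_sampling_prob_le:
  "\<bar>(u $ t) \<bullet> (v $ t) / sampling_prob u v t\<bar> \<le> (\<Sum>j\<in>UNIV. norm (u $ j) * norm (v $ j))"
proof -
  define S where "S = (\<Sum>j\<in>UNIV. norm (u $ j) * norm (v $ j))"
  have S: "0 \<le> S"
    by (simp add: S_def sum_nonneg)
  have "\<bar>(u $ t) \<bullet> (v $ t) / sampling_prob u v t\<bar>
      = \<bar>(u $ t) \<bullet> (v $ t)\<bar> / (norm (u $ t) * norm (v $ t)) * S"
    using S by (simp add: sampling_prob_def abs_mult flip: S_def)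
  also have "\<dots> \<le> 1 * S"
    using S Cauchy_Schwarz_ineq2[of "u $ t" "v $ t"]
    by (intro mult_right_mono) (auto simp: divide_le_eq_1 zero_less_mult_iff)
  finally show ?thesis
    by (simp add: S_def)
qed

text \<open>Cauchy-Schwarz for the sequences of block norms: the norm of a nested vector is the
  Euclidean norm of its block norms.\<close>

lemma sum_norm_mult_norm_le:
  fixes u v :: "real ^ 'd ^ 'n"
  shows "(\<Sum>j\<in>UNIV. norm (u $ j) * norm (v $ j)) \<le> norm u * norm v"
  using L2_set_mult_ineq[of "\<lambda>j. norm (u $ j)" "\<lambda>j. norm (v $ j)" UNIV] by (simp add: norm_vec_def)

text \<open>An entry is a bilinear form at two canonical basis vectors. Moving the transposes of
  \<open>J i\<close> and \<open>R i\<close> to the left argument splits it evenly into the two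
  factors.\<close>

lemma gauss_newton_hessian_entry:
  fixes J :: "'n :: finite \<Rightarrow> real ^ 'w ^ 'd"
  assumes "\<And>i. Q i = transpose (R i) ** R i"
  shows "gauss_newton_hessian J Q $ k $ m = gnh_vector R J k \<bullet> gnh_vector R J m"
proof -
  have entry: "A $ k $ m = axis k 1 \<bullet> (A *v axis m 1)" for A :: "real ^ 'w ^ 'w"
    by (simp add: matrix_vector_mul_component inner_axis' inner_axis)
  have adjoint: "x \<bullet> (transpose A *v y) = (A *v x) \<bullet> y"
    for A :: "real ^ 'b ^ 'c" and x :: "real ^ 'b" and y :: "real ^ 'c"
    by (metis dot_lmul_matrix vector_transpose_matrix)
  have "(transpose (J i) ** Q i ** J i) $ k $ m
      = (R i *v (J i *v axis k 1)) \<bullet> (R i *v (J i *v axis m 1))" for i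
    by (simp only: entry assms adjoint matrix_vector_mul_assoc[symmetric])
  thus ?thesis
    by (simp add: gauss_newton_hessian_def gnh_vector_def inner_vec_def)
qed

theorem theorem3p2:
  fixes s :: "real \<Rightarrow> real"
    and L c :: nat
    and W :: "nat \<Rightarrow> ('d :: {finite, linorder}, 'd) rmat"
    and x0 :: "'n :: finite \<Rightarrow> 'd rvec"
    and y :: "'n \<Rightarrow> 'y"
    and f :: "'d rvec \<Rightarrow> 'y \<Rightarrow> real"
    and xL :: "'n \<Rightarrow> 'd rvec"
    and Q R :: "'n \<Rightarrow> ('d, 'd) rmat"
    and J :: "'n \<Rightarrow> ('d, 'w :: {finite, linorder}) rmat"
    and H :: "('w, 'w) rmat"
    and v :: "'w \<Rightarrow> ('d rvec, 'n) vec"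
    and k m :: 'w
    and M :: "'s measure"
    and T :: "nat \<Rightarrow> 's \<Rightarrow> 'n"
    and Ht :: "'s \<Rightarrow> real"
  assumes N: "CARD('w) = CARD('d)\<^sup>2 * L"
    and s: "\<And>z. s differentiable (at z)"
    and xL: "\<And>i. xL i = forward s W (x0 i) L"
    and f: "\<And>i. twice_differentiable_at (\<lambda>x. f x (y i)) (xL i)"
    and Q: "\<And>i. Q i = (1 / real CARD('n)) *\<^sub>R hessian (\<lambda>x. f x (y i)) (xL i)"
    and Q_sym: "\<And>i. transpose (Q i) = Q i"
    and Q_psd: "\<And>i z. 0 \<le> z \<bullet> (Q i *v z)"
    and R: "\<And>i. Q i = transpose (R i) ** R i"
    and J: "\<And>i. J i = output_jacobian s L W (x0 i)"
    and H: "H = gauss_newton_hessian J Q"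
    and v: "\<And>l. v l = gnh_vector R J l"
    and P_well_defined: "(\<Sum>j\<in>UNIV. norm (v k $ j) * norm (v m $ j)) \<noteq> 0"
    and c: "c \<ge> 1"
    and M: "prob_space M"
    and indep: "prob_space.indep_vars M (\<lambda>_. count_space UNIV) T {1..c}"
    and distr: "\<And>j t. j \<in> {1..c} \<Longrightarrow>
           prob_space.prob M {\<omega> \<in> space M. T j \<omega> = t} = sampling_prob (v k) (v m) t"
    and Ht: "\<And>\<omega>. Ht \<omega> = mc_estimate (v k) (v m) c (\<lambda>j. T j \<omega>)"
  shows "prob_space.expectation M Ht = H $ k $ m
    \<and> prob_space.variance M Ht = prob_space.expectation M (\<lambda>\<omega>. \<bar>H $ k $ m - Ht \<omega>\<bar>\<^sup>2)
    \<and> prob_space.expectation M (\<lambda>\<omega>. \<bar>H $ k $ m - Ht \<omega>\<bar>\<^sup>2)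
        \<le> 1 / real c * (norm (v k))\<^sup>2 * (norm (v m))\<^sup>2
    \<and> (\<forall>\<delta>. 0 < \<delta> \<and> \<delta> < 1 \<longrightarrow>
         prob_space.prob M {\<omega> \<in> space M.
             \<bar>H $ k $ m - Ht \<omega>\<bar>
               \<le> (1 + sqrt (8 * ln (1 / \<delta>))) / sqrt (real c) * norm (v k) * norm (v m)}
           \<ge> 1 - \<delta>)"
proof -
  interpret prob_space M
    by (rule M)
  define S where "S = (\<Sum>j\<in>UNIV. norm (v k $ j) * norm (v m $ j))"
  define g where "g t = (v k $ t) \<bullet> (v m $ t) / sampling_prob (v k) (v m) t" for t
  have S: "0 < S" and S_le: "S \<le> norm (v k) * norm (v m)"
    using P_well_defined sum_norm_mult_norm_le
    by (auto simp: S_def less_le sum_nonneg)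
  have Hkm: "H $ k $ m = (\<Sum>t\<in>UNIV. (v k $ t) \<bullet> (v m $ t))"
    using gauss_newton_hessian_entry[of Q R J k m, OF R] by (simp add: H v inner_vec_def)
  have T: "T j \<in> measurable M (count_space UNIV)" if "j \<in> {1..c}" for j
    using indep that by (auto simp: indep_vars_def)
  \<comment> \<open>The bound used is the total weight \<open>S\<close>, positive as the Hoeffding
    step requires; it is replaced by the larger product of norms only after the variance and tail
    bounds have been applied.\<close>
  interpret indep_abs_bounded_same_mean M "\<lambda>j \<omega>. g (T j \<omega>)" "{1..c}" S "H $ k $ m"
  proof unfold_locales
    show "indep_vars (\<lambda>_. borel) (\<lambda>j \<omega>. g (T j \<omega>)) {1..c}"
      by (rule indep_vars_compose2[OF indep]) simp
    show "\<bar>g (T j \<omega>)\<bar> \<le> S" for j \<omega>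
      unfolding g_def S_def by (rule abs_inner_div_sampling_prob_le)
    show "expectation (\<lambda>\<omega>. g (T j \<omega>)) = H $ k $ m" if "j \<in> {1..c}" for j
      unfolding expectation_finite_range[OF T[OF that], of g] distr[OF that] Hkm unfolding g_def
      by (intro sum.cong refl sampling_prob_mult_ratio P_well_defined)
  qed (use c in auto)
  have Ht_eq: "Ht = sample_mean"
    by (simp add: fun_eq_iff Ht mc_estimate_def g_def)
  have mean: "expectation Ht = H $ k $ m"
    unfolding Ht_eq by (rule expectation_sample_mean)
  have mse: "variance Ht = expectation (\<lambda>\<omega>. \<bar>H $ k $ m - Ht \<omega>\<bar>\<^sup>2)"
    by (simp add: mean power2_commute)
  have "variance Ht \<le> S\<^sup>2 / real c"
    using variance_sample_mean_le unfolding Ht_eq by simp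
  also have "\<dots> \<le> (norm (v k) * norm (v m))\<^sup>2 / real c"
    using S S_le by (intro divide_right_mono power_mono) auto
  finally have var: "variance Ht \<le> 1 / real c * (norm (v k))\<^sup>2 * (norm (v m))\<^sup>2"
    by (simp add: power_mult_distrib)
  have "1 - \<delta> \<le> prob {\<omega> \<in> space M. \<bar>H $ k $ m - Ht \<omega>\<bar>
      \<le> (1 + sqrt (8 * ln (1 / \<delta>))) / sqrt (real c) * norm (v k) * norm (v m)}"
    if \<delta>: "0 < \<delta>" "\<delta> < 1" for \<delta>
  proof -
    let ?\<eta> = "(1 + sqrt (8 * ln (1 / \<delta>))) / sqrt (real c)"
    have "0 \<le> ?\<eta>"
      using \<delta> by (intro divide_nonneg_nonneg add_nonneg_nonneg) auto
    hence le: "?\<eta> * S \<le> ?\<eta> * norm (v k) * norm (v m)"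
      unfolding mult.assoc by (rule mult_left_mono[OF S_le])
    have "1 - \<delta> \<le> prob {\<omega> \<in> space M. \<bar>H $ k $ m - Ht \<omega>\<bar> \<le> ?\<eta> * S}"
      using sample_mean_concentration[OF S \<delta>] unfolding Ht_eq by simp
    \<comment> \<open>Widening the allowed error from \<open>S\<close> to the product of norms
      enlarges the event.\<close>
    also have "\<dots> \<le> prob {\<omega> \<in> space M. \<bar>H $ k $ m - Ht \<omega>\<bar> \<le> ?\<eta> * norm (v k) * norm (v m)}"
    proof (rule finite_measure_mono)
      show "{\<omega> \<in> space M. \<bar>H $ k $ m - Ht \<omega>\<bar> \<le> ?\<eta> * S}
          \<subseteq> {\<omega> \<in> space M. \<bar>H $ k $ m - Ht \<omega>\<bar> \<le> ?\<eta> * norm (v k) * norm (v m)}"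
        using le by auto
      show "{\<omega> \<in> space M. \<bar>H $ k $ m - Ht \<omega>\<bar> \<le> ?\<eta> * norm (v k) * norm (v m)} \<in> events"
        unfolding Ht_eq by measurable
    qed
    finally show ?thesis .
  qed
  with mean mse var show ?thesis
    by auto
qed

end
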